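(* Let $T:S_n(\mathbb{R})\to S_n(\mathbb{R})$ be a linear transformation of rank $2$ given by $T(A)=\operatorname{tr}(AB_1)U_1+\operatorname{tr}(AB_2)U_2$ for all $A\in S_n(\mathbb{R})$, where $B_1,B_2\in S_n(\mathbb{R})$ and $U_1,U_2\in S_n(\mathbb{R})$ are linearly independent and positive definite. Let $W$ be an invertible real $n\times n$ matrix such that $WU_1W^t=I_n$ and $WU_2W^t=\operatorname{diag}(\mu_1,\mu_2,\ldots,\mu_n)$ (with $\mu_i>0$ for $i=1,\ldots,n$), and put $\mu_{\min}=\min\{\mu_1,\ldots,\mu_n\}$ and $\mu_{\max}=\max\{\mu_1,\ldots,\mu_n\}$. Then $T$ is positive definite preserving if and only if both $B_1+\mu_{\min}B_2$ and $B_1+\mu_{\max}B_2$ are non-zero and positive semi-definite.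
   Context: $S_n(\mathbb{R})$ is the real vector space of real symmetric $n\times n$ matrices. The rank of a linear transformation $T:S_n(\mathbb{R})\to S_n(\mathbb{R})$ is the dimension of its image. $T$ is called positive definite preserving if $T(A)$ is positive definite whenever $A\in S_n(\mathbb{R})$ is positive definite. A matrix $W$ as in the claim always exists (simultaneous diagonalization by congruence), and $\mu_1,\ldots,\mu_n$ are the eigenvalues of $U_1^{-1}U_2$. *)

theory Defs
  imports "HOL-Analysis.Analysis"
begin

text \<open>Matrices of size \<open>n\<close> are elements of \<open>real ^ 'n ^ 'n\<close> for a finite index type \<open>'n\<close>.\<close>

definition sym_mats :: "(real ^ 'n ^ 'n) set" where
  "sym_mats = {A. transpose A = A}"

definition pos_def :: "real ^ 'n ^ 'n \<Rightarrow> bool" where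
  "pos_def A \<longleftrightarrow> A \<in> sym_mats \<and> (\<forall>x. x \<noteq> 0 \<longrightarrow> x \<bullet> (A *v x) > 0)"

definition pos_semidef :: "real ^ 'n ^ 'n \<Rightarrow> bool" where
  "pos_semidef A \<longleftrightarrow> A \<in> sym_mats \<and> (\<forall>x. x \<bullet> (A *v x) \<ge> 0)"

definition diag :: "real ^ 'n \<Rightarrow> real ^ 'n ^ 'n" where
  "diag d = (\<chi> i j. if i = j then d $ i else 0)"

text \<open>A linear transformation of the space of symmetric matrices is represented by a function on
  all matrices of which only the values on \<^const>\<open>sym_mats\<close> matter; nothing is required of it
  elsewhere.\<close>

definition linear_on_sym :: "(real ^ 'n ^ 'n \<Rightarrow> real ^ 'n ^ 'n) \<Rightarrow> bool" where
  "linear_on_sym T \<longleftrightarrow>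
    (\<forall>A \<in> sym_mats. T A \<in> sym_mats) \<and>
    (\<forall>A \<in> sym_mats. \<forall>B \<in> sym_mats. T (A + B) = T A + T B) \<and>
    (\<forall>c. \<forall>A \<in> sym_mats. T (c *\<^sub>R A) = c *\<^sub>R T A)"

definition rank_on_sym :: "(real ^ 'n ^ 'n \<Rightarrow> real ^ 'n ^ 'n) \<Rightarrow> nat" where
  "rank_on_sym T = dim (T ` sym_mats)"

definition pos_def_preserving :: "(real ^ 'n ^ 'n \<Rightarrow> real ^ 'n ^ 'n) \<Rightarrow> bool" where
  "pos_def_preserving T \<longleftrightarrow> (\<forall>A \<in> sym_mats. pos_def A \<longrightarrow> pos_def (T A))"

end

theory Submission
  imports Defs
begin

text \<open>After congruence by \<open>W\<close>, the matrix \<open>T A\<close> becomes diagonal with entries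
  \<open>trace (A ** (B1 + \<mu>\<^sub>i *\<^sub>R B2))\<close>. These are affine in \<open>\<mu>\<^sub>i\<close>, so only the extreme values of
  \<open>\<mu>\<close> matter, and the claim reduces to the self-duality of the positive semidefinite cone: a symmetric
  \<open>C\<close> has \<open>trace (A ** C) > 0\<close> for every positive definite \<open>A\<close> iff \<open>C\<close> is nonzero and positive
  semidefinite. That in turn follows by peeling off rank-one terms as in a Cholesky decomposition,
  which avoids the spectral theorem.\<close>

definition outer :: "real ^ 'n \<Rightarrow> real ^ 'n ^ 'n" where
  "outer v = (\<chi> i j. v $ i * v $ j)"

lemma outer_in_sym_mats: "outer v \<in> sym_mats"
  by (simp add: outer_def sym_mats_def transpose_def vec_eq_iff mult.commute)

lemma outer_mult_vec: "outer v *v x = (v \<bullet> x) *\<^sub>R v"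
  by (simp add: outer_def matrix_vector_mult_def inner_vec_def vec_eq_iff sum_distrib_right
      sum_distrib_left mult_ac)

lemma quadratic_form_outer: "x \<bullet> (outer v *v x) = (v \<bullet> x)\<^sup>2"
  by (simp add: outer_mult_vec power2_eq_square inner_commute)

text \<open>This turns the trace pairing into a quadratic form, the link used in both directions of
  the self-duality of the semidefinite cone.\<close>

lemma trace_mult_outer: "trace (A ** outer v) = v \<bullet> (A *v v)"
  by (simp add: trace_def outer_def matrix_matrix_mult_def matrix_vector_mult_def inner_vec_def
      sum_distrib_right sum_distrib_left mult_ac)

lemma trace_mult_add_scaleR:
  fixes A B C :: "real ^ 'n ^ 'n"
  shows "trace (A ** (B + c *\<^sub>R C)) = trace (A ** B) + c * trace (A ** C)"
  by (simp add: trace_def matrix_matrix_mult_def sum.distrib sum_distrib_left algebra_simps)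

lemma sym_mats_add_scaleR:
  assumes "A \<in> sym_mats" "B \<in> sym_mats"
  shows "A + c *\<^sub>R B \<in> sym_mats"
  using assms by (simp add: sym_mats_def transpose_def vec_eq_iff)

lemma mult_vec_add_scaleR:
  fixes A B :: "real ^ 'n ^ 'n"
  shows "(A + c *\<^sub>R B) *v x = A *v x + c *\<^sub>R (B *v x)"
  by (simp add: matrix_vector_mult_def vec_eq_iff sum.distrib sum_distrib_left algebra_simps)

lemma sym_mats_inner_commute:
  assumes "C \<in> sym_mats"
  shows "x \<bullet> (C *v y) = y \<bullet> (C *v x)"
proof -
  have "x \<bullet> (C *v y) = (transpose C *v x) \<bullet> y"
    by (metis dot_lmul_matrix vector_transpose_matrix transpose_transpose)
  then show ?thesis
    using assms by (simp add: sym_mats_def inner_commute del: transpose_matrix_vector)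
qed

lemma discriminant_nonpos:
  fixes a b c :: real
  assumes "c \<ge> 0" and nonneg: "\<And>t. a + 2 * b * t + c * t\<^sup>2 \<ge> 0"
  shows "b\<^sup>2 \<le> a * c"
proof (cases "c = 0")
  case True
  have "b = 0"
  proof (rule ccontr)
    assume "b \<noteq> 0"
    then show False
      \<comment> \<open>At this \<open>t\<close> the affine function \<open>a + 2 * b * t\<close>
        takes the value -1.\<close>
      using nonneg[of "- (a + 1) / (2 * b)"] True by simp
  qed
  with True show ?thesis by simp
next
  case False
  with assms(1) have "c > 0" by simp
  have "0 \<le> a - b\<^sup>2 / c"
    \<comment> \<open>The vertex of the parabola.\<close>
    using nonneg[of "- b / c"] False by (simp add: field_simps power2_eq_square)
  with \<open>c > 0\<close> show ?thesis by (simp add: field_simps)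
qed

text \<open>The form at \<open>x + t *\<^sub>R y\<close> is a nonnegative quadratic polynomial in
  \<open>t\<close>, so its discriminant is nonpositive.\<close>

lemma pos_semidef_Cauchy_Schwarz:
  assumes "pos_semidef C"
  shows "(x \<bullet> (C *v y))\<^sup>2 \<le> (x \<bullet> (C *v x)) * (y \<bullet> (C *v y))"
proof (rule discriminant_nonpos)
  show "y \<bullet> (C *v y) \<ge> 0"
    using assms by (simp add: pos_semidef_def)
next
  fix t :: real
  have "(x + t *\<^sub>R y) \<bullet> (C *v (x + t *\<^sub>R y)) \<ge> 0"
    using assms by (simp add: pos_semidef_def)
  moreover have "y \<bullet> (C *v x) = x \<bullet> (C *v y)"
    using assms by (simp add: pos_semidef_def sym_mats_inner_commute)
  ultimately show "x \<bullet> (C *v x) + 2 * (x \<bullet> (C *v y)) * t + y \<bullet> (C *v y) * t\<^sup>2 \<ge> 0"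
    by (simp add: matrix_vector_right_distrib matrix_vector_mult_scaleR inner_add_left
        inner_add_right power2_eq_square algebra_simps)
qed

lemma pos_semidef_mult_vec_eq_0:
  assumes "pos_semidef C" "x \<bullet> (C *v x) = 0"
  shows "C *v x = 0"
proof -
  have "((C *v x) \<bullet> (C *v x))\<^sup>2 \<le> 0"
    \<comment> \<open>Pairing \<open>x\<close> with \<open>C *v x\<close> itself bounds the fourth
      power of the norm of \<open>C *v x\<close> by 0.\<close>
    using pos_semidef_Cauchy_Schwarz[OF assms(1), of "C *v x" x] assms(2) by simp
  then show ?thesis by simp
qed

text \<open>Induction on the number of nonzero columns of \<open>C\<close>. For a nonzero column
  \<open>v\<close> with diagonal entry \<open>d\<close>, subtracting \<open>outer v\<close> divided
  by \<open>d\<close> (a Schur complement) clears that column and keeps the matrix positive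
  semidefinite; the removed term has positive trace against \<open>A\<close>.\<close>

lemma trace_pos_def_pos_semidef_pos:
  fixes A C :: "real ^ 'n ^ 'n"
  assumes "pos_def A" "pos_semidef C" "C \<noteq> 0"
  shows "trace (A ** C) > 0"
  using assms(2,3)
proof (induction "card {i. C *v axis i 1 \<noteq> 0}" arbitrary: C rule: less_induct)
  case less
  obtain i where i: "C *v axis i 1 \<noteq> 0"
  proof (rule ccontr)
    assume "\<not> thesis"
    then have "\<And>i. C *v axis i 1 = 0" using that by blast
    then have "C = 0"
      by (simp add: matrix_vector_mult_basis column_def vec_eq_iff)
    with less.prems show False by simp
  qed
  define v where "v = C *v axis i 1"
  define d where "d = axis i 1 \<bullet> v"
  define C' where "C' = C + (- 1 / d) *\<^sub>R outer v"
  have sym: "C \<in> sym_mats" using less.prems by (simp add: pos_semidef_def)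
  \<comment> \<open>A zero diagonal entry of a positive semidefinite matrix would force its whole
    column to vanish.\<close>
  have "d > 0"
    using pos_semidef_mult_vec_eq_0[OF less.prems(1), of "axis i 1"] i less.prems(1)
    by (force simp: d_def v_def pos_semidef_def order_less_le)
  have C'_mult: "C' *v x = C *v x - ((v \<bullet> x) / d) *\<^sub>R v" for x
    unfolding C'_def mult_vec_add_scaleR outer_mult_vec by simp
  have v_inner: "v \<bullet> x = axis i 1 \<bullet> (C *v x)" for x
    using sym_mats_inner_commute[OF sym, of x "axis i 1"] by (simp add: v_def inner_commute)
  have psd: "pos_semidef C'"
    unfolding pos_semidef_def
  proof (intro conjI allI)
    show "C' \<in> sym_mats"
      unfolding C'_def by (intro sym_mats_add_scaleR sym outer_in_sym_mats)
    fix x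
    \<comment> \<open>Nonnegativity of the form of \<open>C'\<close> at \<open>x\<close> is exactly
      Cauchy-Schwarz for \<open>axis i 1\<close> and \<open>x\<close>.\<close>
    have "(v \<bullet> x)\<^sup>2 \<le> d * (x \<bullet> (C *v x))"
      unfolding v_inner unfolding d_def v_def by (rule pos_semidef_Cauchy_Schwarz[OF less.prems(1)])
    then show "x \<bullet> (C' *v x) \<ge> 0"
      using \<open>d > 0\<close> by (simp add: C'_mult inner_diff_right inner_commute field_simps power2_eq_square)
  qed
  have "{j. C' *v axis j 1 \<noteq> 0} \<subset> {j. C *v axis j 1 \<noteq> 0}"
  proof (rule psubsetI)
    \<comment> \<open>If column \<open>j\<close> of \<open>C\<close> is zero, then so is entry
      \<open>j\<close> of \<open>v\<close>, by symmetry, and the subtraction leaves the column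
      zero.\<close>
    show "{j. C' *v axis j 1 \<noteq> 0} \<subseteq> {j. C *v axis j 1 \<noteq> 0}"
      by (auto simp: C'_mult v_inner)
    have "C' *v axis i 1 = 0"
      using \<open>d > 0\<close> by (simp add: C'_mult v_inner flip: v_def d_def)
    with i show "{j. C' *v axis j 1 \<noteq> 0} \<noteq> {j. C *v axis j 1 \<noteq> 0}" by blast
  qed
  then have "card {j. C' *v axis j 1 \<noteq> 0} < card {j. C *v axis j 1 \<noteq> 0}"
    by (intro psubset_card_mono) auto
  \<comment> \<open>Only a weak inequality, since \<open>C'\<close> may be 0; strictness comes from
    the removed term.\<close>
  then have "trace (A ** C') \<ge> 0"
    using less.hyps[OF _ psd] by (cases "C' = 0") (auto simp: trace_def matrix_matrix_mult_def less_imp_le)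
  moreover have "v \<bullet> (A *v v) > 0"
    using assms(1) i by (simp add: pos_def_def v_def)
  moreover have "trace (A ** C) = trace (A ** C') + (v \<bullet> (A *v v)) / d"
    unfolding C'_def trace_mult_add_scaleR trace_mult_outer by simp
  ultimately show ?case using \<open>d > 0\<close> by (simp add: add_nonneg_pos)
qed

lemma pos_def_mat_1: "pos_def (mat 1)"
  by (simp add: pos_def_def sym_mats_def)

lemma pos_def_outer_add_scaleR_mat_1:
  assumes "e > 0"
  shows "pos_def (outer v + e *\<^sub>R mat 1)"
  using assms pos_def_mat_1 sym_mats_add_scaleR[OF outer_in_sym_mats]
  by (auto simp: pos_def_def mult_vec_add_scaleR inner_add_right quadratic_form_outer
      intro: add_nonneg_pos)

text \<open>For the forward direction, rank-one matrices \<open>outer x\<close> would be the natural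
  test matrices. They are only semidefinite in general, so a small multiple of the identity is added
  and then sent to 0.\<close>

lemma trace_pos_def_pos_iff:
  fixes C :: "real ^ 'n ^ 'n"
  assumes "C \<in> sym_mats"
  shows "(\<forall>A. pos_def A \<longrightarrow> trace (A ** C) > 0) \<longleftrightarrow> C \<noteq> 0 \<and> pos_semidef C"
proof
  assume pos: "\<forall>A. pos_def A \<longrightarrow> trace (A ** C) > 0"
  have tr: "trace C > 0"
    using pos pos_def_mat_1 by (metis matrix_mul_lid)
  have "x \<bullet> (C *v x) \<ge> 0" for x
  proof (rule field_le_epsilon)
    fix e :: real
    assume "e > 0"
    \<comment> \<open>The factor is chosen so that the identity part contributes exactly
      \<open>e\<close>.\<close>
    then have "trace ((outer x + (e / trace C) *\<^sub>R mat 1) ** C) > 0"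
      using pos tr by (simp add: pos_def_outer_add_scaleR_mat_1)
    then show "0 \<le> x \<bullet> (C *v x) + e"
      using tr by (simp add: trace_mul_sym[of _ C] trace_mult_add_scaleR trace_mult_outer)
  qed
  then show "C \<noteq> 0 \<and> pos_semidef C"
    using assms tr by (auto simp: pos_semidef_def trace_def)
next
  assume "C \<noteq> 0 \<and> pos_semidef C"
  then show "\<forall>A. pos_def A \<longrightarrow> trace (A ** C) > 0"
    by (blast intro: trace_pos_def_pos_semidef_pos)
qed

text \<open>The form of the congruent matrix at \<open>x\<close> is the form of \<open>M\<close> at
  \<open>transpose W *v x\<close>, and \<open>transpose W\<close> permutes the nonzero
  vectors.\<close>

lemma pos_def_congruence_iff:
  fixes M W :: "real ^ 'n ^ 'n"
  assumes "invertible W" "M \<in> sym_mats"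
  shows "pos_def (W ** M ** transpose W) \<longleftrightarrow> pos_def M"
proof -
  have form: "x \<bullet> ((W ** M ** transpose W) *v x) = (transpose W *v x) \<bullet> (M *v (transpose W *v x))" for x
    by (metis dot_lmul_matrix transpose_matrix_vector matrix_vector_mul_assoc matrix_mul_assoc)
  have sym: "W ** M ** transpose W \<in> sym_mats"
    using assms(2) by (simp add: sym_mats_def matrix_transpose_mul matrix_mul_assoc)
  obtain V where V: "V ** transpose W = mat 1" "transpose W ** V = mat 1"
    using assms(1) transpose_invertible[of W] by (metis invertible_def)
  have surj: "\<exists>x. y = transpose W *v x" for y
    using V by (metis matrix_vector_mul_assoc matrix_vector_mul_lid)
  have nz: "transpose W *v x = 0 \<longleftrightarrow> x = 0" for x
    using V by (metis matrix_vector_mul_assoc matrix_vector_mul_lid matrix_vector_mult_0_right)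
  show ?thesis
    unfolding pos_def_def using assms(2) sym form surj nz by metis
qed

lemma pos_def_diag_iff: "pos_def (diag d) \<longleftrightarrow> (\<forall>i. d $ i > 0)"
proof -
  have mult: "diag d *v x = (\<chi> i. d $ i * x $ i)" for x
    by (simp add: diag_def matrix_vector_mult_def vec_eq_iff if_distrib[of "\<lambda>a. a * _"] cong: if_cong)
  have form: "x \<bullet> (diag d *v x) = (\<Sum>i\<in>UNIV. d $ i * (x $ i)\<^sup>2)" for x
    by (simp add: mult inner_vec_def power2_eq_square mult_ac)
  have sym: "diag d \<in> sym_mats"
    by (auto simp: sym_mats_def diag_def transpose_def vec_eq_iff)
  show ?thesis
  proof
    assume "pos_def (diag d)"
    then have "axis i 1 \<bullet> (diag d *v axis i 1) > 0" for i
      by (simp add: pos_def_def)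
    then show "\<forall>i. d $ i > 0"
      by (simp add: mult inner_axis')
  next
    assume d: "\<forall>i. d $ i > 0"
    have "x \<bullet> (diag d *v x) > 0" if nz: "x \<noteq> 0" for x
    proof -
      obtain k where "x $ k \<noteq> 0" using nz by (metis vec_eq_iff zero_index)
      then show ?thesis
        unfolding form using d by (intro sum_pos2[of _ k]) (auto simp: less_imp_le)
    qed
    with sym show "pos_def (diag d)" by (simp add: pos_def_def)
  qed
qed

lemma affine_pos_on_finite_iff:
  fixes a b :: real and S :: "real set"
  assumes "finite S" "S \<noteq> {}"
  shows "(\<forall>s\<in>S. a + b * s > 0) \<longleftrightarrow> a + b * Min S > 0 \<and> a + b * Max S > 0"
proof
  assume "\<forall>s\<in>S. a + b * s > 0"
  then show "a + b * Min S > 0 \<and> a + b * Max S > 0"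
    using assms by simp
next
  assume pos: "a + b * Min S > 0 \<and> a + b * Max S > 0"
  show "\<forall>s\<in>S. a + b * s > 0"
  proof
    fix s
    assume "s \<in> S"
    then have "Min S \<le> s" "s \<le> Max S" using assms by auto
    \<comment> \<open>The sign of \<open>b\<close> decides which endpoint gives the lower
      bound.\<close>
    then have "b * Min S \<le> b * s \<or> b * Max S \<le> b * s"
      by (cases "b \<ge> 0") (auto intro: mult_left_mono mult_left_mono_neg)
    with pos show "a + b * s > 0" by linarith
  qed
qed

theorem theorem3p2:
  fixes T :: "real ^ 'n ^ 'n \<Rightarrow> real ^ 'n ^ 'n"
    and B1 B2 U1 U2 W :: "real ^ 'n ^ 'n"
    and \<mu> :: "real ^ 'n"
    and \<mu>min \<mu>max :: real
  assumes "linear_on_sym T"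
    and "rank_on_sym T = 2"
    and "B1 \<in> sym_mats" and "B2 \<in> sym_mats"
    and "U1 \<in> sym_mats" and "U2 \<in> sym_mats"
    and "\<And>A. A \<in> sym_mats \<Longrightarrow> T A = trace (A ** B1) *\<^sub>R U1 + trace (A ** B2) *\<^sub>R U2"
    and "U1 \<noteq> U2" and "independent {U1, U2}"
    and "pos_def U1" and "pos_def U2"
    and "invertible W"
    and "W ** U1 ** transpose W = mat 1"
    and "W ** U2 ** transpose W = diag \<mu>"
    and "\<And>i. \<mu> $ i > 0"
    and "\<mu>min = Min (range (\<lambda>i. \<mu> $ i))"
    and "\<mu>max = Max (range (\<lambda>i. \<mu> $ i))"
  shows "pos_def_preserving T \<longleftrightarrow>
    (B1 + \<mu>min *\<^sub>R B2 \<noteq> 0 \<and> pos_semidef (B1 + \<mu>min *\<^sub>R B2)) \<and>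
    (B1 + \<mu>max *\<^sub>R B2 \<noteq> 0 \<and> pos_semidef (B1 + \<mu>max *\<^sub>R B2))"
proof -
  have W: "invertible W" by fact
  \<comment> \<open>For a fixed \<open>A\<close>, congruence by \<open>W\<close> reduces positive
    definiteness of \<open>T A\<close> to finitely many affine inequalities in the entries of
    \<open>\<mu>\<close>.\<close>
  have pd: "pos_def (T A) \<longleftrightarrow>
      trace (A ** (B1 + \<mu>min *\<^sub>R B2)) > 0 \<and> trace (A ** (B1 + \<mu>max *\<^sub>R B2)) > 0"
    if "A \<in> sym_mats" for A
  proof -
    define a where "a = trace (A ** B1)"
    define b where "b = trace (A ** B2)"
    have TA: "T A = a *\<^sub>R U1 + b *\<^sub>R U2"
      using assms(7)[OF that] by (simp add: a_def b_def)
    have sym: "T A \<in> sym_mats"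
      using assms(1) that by (simp add: linear_on_sym_def)
    have "W ** T A ** transpose W
        = a *\<^sub>R (W ** U1 ** transpose W) + b *\<^sub>R (W ** U2 ** transpose W)"
      by (simp add: TA matrix_matrix_mult_def vec_eq_iff sum.distrib sum_distrib_left sum_distrib_right
          algebra_simps)
    also have "\<dots> = diag (\<chi> i. a + b * \<mu> $ i)"
      unfolding assms(13) assms(14) by (simp add: diag_def mat_def vec_eq_iff)
    finally have "pos_def (T A) \<longleftrightarrow> (\<forall>i. a + b * \<mu> $ i > 0)"
      using pos_def_congruence_iff[OF W sym] by (simp add: pos_def_diag_iff)
    also have "\<dots> \<longleftrightarrow> a + b * \<mu>min > 0 \<and> a + b * \<mu>max > 0"
      using affine_pos_on_finite_iff[of "range (\<lambda>i. \<mu> $ i)" a b] assms(16,17) by simp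
    finally show ?thesis
      by (simp add: trace_mult_add_scaleR a_def b_def mult.commute)
  qed
  \<comment> \<open>Quantifying over \<open>A\<close> splits the conjunction, so self-duality
    applies to each extreme value separately.\<close>
  have "pos_def_preserving T \<longleftrightarrow>
      (\<forall>A. pos_def A \<longrightarrow> trace (A ** (B1 + \<mu>min *\<^sub>R B2)) > 0) \<and>
      (\<forall>A. pos_def A \<longrightarrow> trace (A ** (B1 + \<mu>max *\<^sub>R B2)) > 0)"
    using pd by (auto simp: pos_def_preserving_def pos_def_def)
  then show ?thesis
    using assms(3,4) by (simp add: trace_pos_def_pos_iff sym_mats_add_scaleR)
qed

end
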